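(* Let $v$ be a positive odd integer and let $g,b$ be positive integers. If there exists a $(v,g,b)$ non-half-sum Latin rectangle (NHSLR), then there exists a $(v,\,vg,\,(v-b)g,\,bv)$ placement delivery array (PDA). This PDA realizes, for every positive integer $N$, a $(K=v,M,N)$ coded caching scheme with memory ratio $M/N=1-\frac{b}{v}$, subpacketization $F=vg$, and transmission load $R=\frac{b}{g}$.
   Context: Notation: $[a]=\{1,\dots,a\}$; $\mathbb{Z}_v$ is the ring of integers modulo $v$. NHSLR. For a positive odd integer $v$ and positive integers $g,b$, a $g\times b$ array $\mathbf{D}$ with entries in $\mathbb{Z}_v$ is a $(v,g,b)$ NHSLR if: (i) each element of $\mathbb{Z}_v$ appears at most once in each row and at most once in each column of $\mathbf{D}$; (ii) for any two distinct rows $\mathbf{d},\mathbf{d}'$ of $\mathbf{D}$ (rows at two different row positions), no entry of the vector $\frac12(\mathbf{d}+\mathbf{d}')$ (computed entrywise in $\mathbb{Z}_v$, where $2$ is invertible since $v$ is odd) appears as an entry of $\mathbf{d}$ or of $\mathbf{d}'$. PDA. An $F\times K$ array $\mathbf{P}=(p_{j,k})$ with entries in $\{*\}\cup[S]$ (or $\{*\}\cup\Sigma$ for any symbol set $\Sigma$ of size $S$) is a $(K,F,Z,S)$ PDA if: C1. each column contains exactly $Z$ stars; C2. each of the $S$ non-star symbols occurs at least once; C3. whenever two distinct positions $(j_1,k_1)\ne(j_2,k_2)$ satisfy $p_{j_1,k_1}=p_{j_2,k_2}=s\neq *$, then $j_1\ne j_2$, $k_1\ne k_2$ and $p_{j_1,k_2}=p_{j_2,k_1}=*$.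 Coded caching. In a $(K,M,N)$ system a server holds $N$ equal-size files and is connected by an error-free shared (broadcast) link to $K$ users, each having a cache of size $M$ files ($0\le M\le N$). An $F$-division scheme (uncoded placement) has two phases. Placement: each file $W_n$ is split into $F$ equal-size packets $W_{n,1},\dots,W_{n,F}$ (bit strings of a common length), and each user caches some packets, of total size at most $M$ files, without knowing the demands. Delivery: given any demand vector $\mathbf{d}=(d_1,\dots,d_K)\in[N]^K$, the server broadcasts $R_{\mathbf d}F$ coded packets (XORs of packets) so that each user $k$ can recover $W_{d_k}$ from the broadcast and its cache. $F$ is the subpacketization, $M/N$ the memory ratio, and the load is $R=\max_{\mathbf d}R_{\mathbf d}$. A $(K,F,Z,S)$ PDA realizes the $F$-division scheme in which user $k$ caches packet $j$ of every file exactly when $p_{j,k}=*$, and for every non-star symbol $s$ the server sends $\bigoplus_{(j,k):\,p_{j,k}=s}W_{d_k,j}$; thus $M/N=Z/F$ and $R=S/F$. *)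

theory Defs
  imports Complex_Main "HOL-Library.Multiset" "HOL-Library.FuncSet" "HOL-Number_Theory.Number_Theory"
begin

text \<open>
  An \<open>m \<times> n\<close> array is a function \<open>A\<close> whose relevant entries are \<open>A i j\<close> for
  \<open>i \<in> {1..m}\<close> (rows) and \<open>j \<in> {1..n}\<close> (columns).  The ring of integers modulo \<open>v\<close> is
  represented by the canonical residues \<open>{0..<v}\<close> (this includes the zero ring \<open>v = 1\<close>).
\<close>

definition half_sum :: "nat \<Rightarrow> int \<Rightarrow> int \<Rightarrow> int" where
  "half_sum v x y = (modular_inverse (int v) 2 * (x + y)) mod int v"

definition is_NHSLR :: "nat \<Rightarrow> nat \<Rightarrow> nat \<Rightarrow> (nat \<Rightarrow> nat \<Rightarrow> int) \<Rightarrow> bool" where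
  "is_NHSLR v g b D \<longleftrightarrow>
     (\<forall>i\<in>{1..g}. \<forall>j\<in>{1..b}. D i j \<in> {0..<int v}) \<and>
     (\<forall>i\<in>{1..g}. inj_on (\<lambda>j. D i j) {1..b}) \<and>
     (\<forall>j\<in>{1..b}. inj_on (\<lambda>i. D i j) {1..g}) \<and>
     (\<forall>i\<in>{1..g}. \<forall>i'\<in>{1..g}. i \<noteq> i' \<longrightarrow>
        (\<forall>j\<in>{1..b}. half_sum v (D i j) (D i' j) \<notin> D i ` {1..b} \<union> D i' ` {1..b}))"

text \<open>The star is \<^term>\<open>None\<close>, and the other symbols are \<open>Some s\<close> with \<open>s \<in> {1..S}\<close>.\<close>

definition is_PDA :: "nat \<Rightarrow> nat \<Rightarrow> nat \<Rightarrow> nat \<Rightarrow> (nat \<Rightarrow> nat \<Rightarrow> nat option) \<Rightarrow> bool" where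
  "is_PDA K F Z S P \<longleftrightarrow>
     (\<forall>j\<in>{1..F}. \<forall>k\<in>{1..K}. P j k \<in> insert None (Some ` {1..S})) \<and>
     (\<forall>k\<in>{1..K}. card {j \<in> {1..F}. P j k = None} = Z) \<and>
     (\<forall>s\<in>{1..S}. \<exists>j\<in>{1..F}. \<exists>k\<in>{1..K}. P j k = Some s) \<and>
     (\<forall>j1\<in>{1..F}. \<forall>k1\<in>{1..K}. \<forall>j2\<in>{1..F}. \<forall>k2\<in>{1..K}. \<forall>s.
        (j1, k1) \<noteq> (j2, k2) \<and> P j1 k1 = Some s \<and> P j2 k2 = Some s \<longrightarrow>
          j1 \<noteq> j2 \<and> k1 \<noteq> k2 \<and> P j1 k2 = None \<and> P j2 k1 = None)"

text \<open>
  The label \<open>(n, j)\<close> stands for packet \<open>j\<close> of file \<open>n\<close>.  For a scheme \<open>C\<close>, \<open>cached C k\<close> is the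
  set of packets stored by user \<open>k\<close>; it does not depend on the demands.  For a demand vector \<open>d\<close>,
  \<open>broadcast C d\<close> lists the coded packets sent, each given by the multiset of packets that are
  combined by XOR.
\<close>

type_synonym packet = "nat \<times> nat"

record caching_scheme =
  cached :: "nat \<Rightarrow> packet set"
  broadcast :: "(nat \<Rightarrow> nat) \<Rightarrow> packet multiset list"

definition demands :: "nat \<Rightarrow> nat \<Rightarrow> (nat \<Rightarrow> nat) set" where
  "demands K N = {1..K} \<rightarrow>\<^sub>E {1..N}"

text \<open>The bitwise XOR of the bit strings \<open>W p\<close>, all of length \<open>L\<close>, for \<open>p\<close> in a multiset.\<close>

definition xor_packets :: "nat \<Rightarrow> (packet \<Rightarrow> bool list) \<Rightarrow> packet multiset \<Rightarrow> bool list" where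
  "xor_packets L W A = map (\<lambda>i. odd (size {# p \<in># A. W p ! i #})) [0..<L]"

text \<open>
  User \<open>k\<close> can recover its file \<open>d k\<close>: for every packet length \<open>L\<close> there is a decoder which,
  from the received bit strings and the contents of the cache alone (the function \<open>W\<close> restricted
  to the cached labels), returns all packets of that file, whatever the contents \<open>W\<close> of the files.
\<close>

definition can_decode ::
    "nat \<Rightarrow> nat \<Rightarrow> caching_scheme \<Rightarrow> (nat \<Rightarrow> nat) \<Rightarrow> nat \<Rightarrow> bool" where
  "can_decode N F C d k \<longleftrightarrow>
     (\<forall>L. \<exists>dec :: bool list list \<Rightarrow> (packet \<Rightarrow> bool list) \<Rightarrow> nat \<Rightarrow> bool list.
        \<forall>W. (\<forall>p \<in> {1..N} \<times> {1..F}. length (W p) = L) \<longrightarrow>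
          (\<forall>j\<in>{1..F}.
             dec (map (xor_packets L W) (broadcast C d)) (restrict W (cached C k)) j = W (d k, j)))"

text \<open>\<open>C\<close> is an \<open>F\<close>-division scheme for the \<open>(K, M, N)\<close> system.\<close>

definition is_division_scheme :: "nat \<Rightarrow> real \<Rightarrow> nat \<Rightarrow> nat \<Rightarrow> caching_scheme \<Rightarrow> bool" where
  "is_division_scheme K M N F C \<longleftrightarrow>
     0 < K \<and> 0 < N \<and> 0 < F \<and> 0 \<le> M \<and> M \<le> real N \<and>
     (\<forall>k\<in>{1..K}. cached C k \<subseteq> {1..N} \<times> {1..F} \<and> real (card (cached C k)) / real F \<le> M) \<and>
     (\<forall>d\<in>demands K N.
        (\<forall>A \<in> set (broadcast C d). set_mset A \<subseteq> {1..N} \<times> {1..F}) \<and>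
        (\<forall>k\<in>{1..K}. can_decode N F C d k))"

definition load :: "nat \<Rightarrow> nat \<Rightarrow> nat \<Rightarrow> caching_scheme \<Rightarrow> real" where
  "load K N F C = (MAX d \<in> demands K N. real (length (broadcast C d)) / real F)"

definition PDA_scheme ::
    "nat \<Rightarrow> nat \<Rightarrow> nat \<Rightarrow> (nat \<Rightarrow> nat \<Rightarrow> nat option) \<Rightarrow> nat \<Rightarrow> caching_scheme" where
  "PDA_scheme K F S P N =
     \<lparr> cached = (\<lambda>k. {(n, j). n \<in> {1..N} \<and> j \<in> {1..F} \<and> P j k = None}),
       broadcast = (\<lambda>d. map (\<lambda>s. image_mset (\<lambda>(j, k). (d k, j))
           (mset_set {(j, k). j \<in> {1..F} \<and> k \<in> {1..K} \<and> P j k = Some s})) [1..<S + 1]) \<rparr>"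

end

theory Submission
  imports Defs
begin

text \<open>
  Index the rows of the array by pairs \<open>(i, f)\<close> of a row \<open>i\<close> of the rectangle \<open>D\<close> and a residue
  \<open>f\<close>, and the columns by residues \<open>k\<close>.  The cell is a star unless \<open>k - f\<close> occurs in row \<open>i\<close>
  of \<open>D\<close>, in which case its symbol is \<open>(k + f, j)\<close> with \<open>D i j = k - f\<close>.  Since 2 is invertible,
  \<open>(k + f, k - f)\<close> determines \<open>(k, f)\<close>, so two cells with the same symbol have different \<open>i\<close>, and
  the two cells completing the rectangle they span ask for the half-sum of two entries in the
  same column of \<open>D\<close>, which both rows of \<open>D\<close> avoid.
\<close>

section \<open>The caching scheme of a placement delivery array\<close>

definition symbol_cells ::
    "nat \<Rightarrow> nat \<Rightarrow> (nat \<Rightarrow> nat \<Rightarrow> nat option) \<Rightarrow> nat \<Rightarrow> (nat \<times> nat) set" where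
  "symbol_cells K F P s = {(j, k). j \<in> {1..F} \<and> k \<in> {1..K} \<and> P j k = Some s}"

lemma finite_symbol_cells [simp]: "finite (symbol_cells K F P s)"
  by (rule finite_subset[of _ "{1..F} \<times> {1..K}"]) (auto simp: symbol_cells_def)

lemma cached_PDA_scheme:
  "cached (PDA_scheme K F S P N) k = {1..N} \<times> {j \<in> {1..F}. P j k = None}"
  by (auto simp: PDA_scheme_def)

lemma broadcast_PDA_scheme:
  "broadcast (PDA_scheme K F S P N) d =
     map (\<lambda>s. image_mset (\<lambda>(j, k). (d k, j)) (mset_set (symbol_cells K F P s))) [1..<S + 1]"
  by (simp add: PDA_scheme_def symbol_cells_def)

lemma length_broadcast_PDA_scheme [simp]: "length (broadcast (PDA_scheme K F S P N) d) = S"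
  by (simp add: broadcast_PDA_scheme)

lemma PDA_starD:
  assumes "is_PDA K F Z S P" "(j, k) \<in> symbol_cells K F P s" "(j', k') \<in> symbol_cells K F P s"
    and "(j, k) \<noteq> (j', k')"
  shows "P j' k = None"
  using assms unfolding is_PDA_def symbol_cells_def by blast

text \<open>All packets XORed with the wanted one sit in starred cells of the user's column,
  so the user cancels them.\<close>

lemma can_decode_PDA_scheme:
  assumes PDA: "is_PDA K F Z S P" and d: "d \<in> demands K N" and k: "k \<in> {1..K}"
  shows "can_decode N F (PDA_scheme K F S P N) d k"
  unfolding can_decode_def
proof (intro allI)
  fix L
  let ?C = "PDA_scheme K F S P N"
  let ?f = "\<lambda>(j, k). (d k, j)"
  define others where
    "others = (\<lambda>j s. image_mset ?f (mset_set (symbol_cells K F P s - {(j, k)})))"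
  \<comment> \<open>The demand vector, \<open>k\<close> and \<open>P\<close> are fixed here, so the
    decoder may use them. Index \<open>s - 1\<close> appears because symbols start at 1, and
    \<open>\<noteq>\<close> on bits is XOR.\<close>
  define dec :: "bool list list \<Rightarrow> (packet \<Rightarrow> bool list) \<Rightarrow> nat \<Rightarrow> bool list" where
    "dec = (\<lambda>x w j. case P j k of None \<Rightarrow> w (d k, j)
       | Some s \<Rightarrow> map (\<lambda>i. (x ! (s - 1)) ! i \<noteq> odd (size {# p \<in># others j s. w p ! i #})) [0..<L])"
  have dN: "d k' \<in> {1..N}" if "k' \<in> {1..K}" for k'
    using d that by (auto simp: demands_def PiE_def Pi_def)
  have "dec (map (xor_packets L W) (broadcast ?C d)) (restrict W (cached ?C k)) j = W (d k, j)"
    if W: "\<forall>p \<in> {1..N} \<times> {1..F}. length (W p) = L" and j: "j \<in> {1..F}" for W j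
  proof (cases "P j k")
    case None
    then have "(d k, j) \<in> cached ?C k"
      using dN[OF k] j by (simp add: cached_PDA_scheme)
    with None show ?thesis by (simp add: dec_def)
  next
    case (Some s)
    let ?A = "symbol_cells K F P s"
    have s: "s \<in> {1..S}"
      using PDA j k Some unfolding is_PDA_def by fastforce
    have jk: "(j, k) \<in> ?A"
      using j k Some by (simp add: symbol_cells_def)
    have others_cached: "p \<in> cached ?C k" if "p \<in># others j s" for p
    proof -
      from that obtain j' k' where p: "p = (d k', j')" "(j', k') \<in> ?A" "(j', k') \<noteq> (j, k)"
        by (auto simp: others_def)
      then have "P j' k = None"
        using PDA_starD[OF PDA jk p(2)] by auto
      with p dN show ?thesis
        by (auto simp: cached_PDA_scheme symbol_cells_def)
    qed
    have sent: "image_mset ?f (mset_set ?A) = add_mset (d k, j) (others j s)"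
      using jk by (simp add: others_def mset_set.remove)
    have len: "length (W (d k, j)) = L"
      using W dN[OF k] j by auto
    have nth: "map (xor_packets L W) (broadcast ?C d) ! (s - 1) =
        xor_packets L W (add_mset (d k, j) (others j s))"
    proof -
      have "s - 1 < S" "[1..<S + 1] ! (s - 1) = s"
        using s by (auto simp del: upt_Suc)
      then show ?thesis
        unfolding sent[symmetric] by (simp add: broadcast_PDA_scheme del: upt_Suc)
    qed
    \<comment> \<open>The decoder sees only the restriction of \<open>W\<close> to the cache, which
      agrees with \<open>W\<close> on all the interfering packets.\<close>
    have filter: "{# p \<in># others j s. restrict W (cached ?C k) p ! i #} =
        {# p \<in># others j s. W p ! i #}" for i
      by (rule filter_mset_cong) (use others_cached in auto)
    show ?thesis
      unfolding dec_def Some nth filter option.case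
      by (rule nth_equalityI) (auto simp: len xor_packets_def)
  qed
  then show "\<exists>dec. \<forall>W. (\<forall>p\<in>{1..N} \<times> {1..F}. length (W p) = L) \<longrightarrow>
      (\<forall>j\<in>{1..F}. dec (map (xor_packets L W) (broadcast ?C d)) (restrict W (cached ?C k)) j =
        W (d k, j))"
    by blast
qed

lemma is_division_scheme_PDA_scheme:
  assumes PDA: "is_PDA K F Z S P" and pos: "K > 0" "N > 0" "F > 0"
  shows "is_division_scheme K (real N * (real Z / real F)) N F (PDA_scheme K F S P N)"
proof -
  let ?C = "PDA_scheme K F S P N"
  have Z: "card {j \<in> {1..F}. P j k = None} = Z" if "k \<in> {1..K}" for k
    using PDA that by (simp add: is_PDA_def)
  \<comment> \<open>Column 1 exists since \<open>K > 0\<close>; its star count bounds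
    \<open>Z\<close> by \<open>F\<close>, which gives \<open>M \<le> N\<close>.\<close>
  have "Z = card {j \<in> {1..F}. P j 1 = None}"
    using Z[of 1] pos by simp
  also have "\<dots> \<le> card {1..F}"
    by (rule card_mono) auto
  finally have ZF: "Z \<le> F" by simp
  have "real (card (cached ?C k)) / real F \<le> real N * (real Z / real F)" if "k \<in> {1..K}" for k
    by (simp only: cached_PDA_scheme card_cartesian_product Z[OF that]) simp
  moreover have "set_mset A \<subseteq> {1..N} \<times> {1..F}"
    if d: "d \<in> demands K N" and "A \<in> set (broadcast ?C d)" for d A
  proof
    fix p assume "p \<in># A"
    with that(2) obtain s j k where "p = (d k, j)" "(j, k) \<in> symbol_cells K F P s"
      by (auto simp: broadcast_PDA_scheme simp del: upt_Suc)
    then show "p \<in> {1..N} \<times> {1..F}"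
      using d by (auto simp: symbol_cells_def demands_def PiE_def Pi_def)
  qed
  moreover have "real N * (real Z / real F) \<le> real N"
    using ZF pos by (intro mult_left_le) simp_all
  ultimately show ?thesis
    unfolding is_division_scheme_def
    using pos can_decode_PDA_scheme[OF PDA] by (auto simp: cached_PDA_scheme)
qed

text \<open>Every demand costs \<open>S\<close> transmissions, so the maximum runs over a constant;
  \<open>N > 0\<close> makes the set of demands nonempty.\<close>

lemma load_PDA_scheme:
  assumes "N > 0"
  shows "load K N F (PDA_scheme K F S P N) = real S / real F"
proof -
  have "demands K N \<noteq> {}"
    using assms by (auto simp: demands_def PiE_eq_empty_iff)
  then have "(\<lambda>d. real (length (broadcast (PDA_scheme K F S P N) d)) / real F) ` demands K N
      = {real S / real F}"
    by auto
  then show ?thesis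
    by (simp only: load_def) simp
qed

section \<open>The array of a non-half-sum Latin rectangle\<close>

text \<open>The inverse of 2 cancels the factor 2, so a half-sum can be identified without computing
  that inverse.\<close>

lemma half_sum_cong:
  assumes "odd v" "[x + y = 2 * z] (mod int v)"
  shows "half_sum v x y = z mod int v"
proof -
  have "coprime 2 (int v)"
    using assms(1) by simp
  then have "[modular_inverse (int v) 2 * 2 = 1] (mod int v)"
    by (rule cong_modular_inverse2)
  then have "[modular_inverse (int v) 2 * 2 * z = 1 * z] (mod int v)"
    by (rule cong_scalar_right)
  moreover have "[modular_inverse (int v) 2 * (x + y) = modular_inverse (int v) 2 * (2 * z)] (mod int v)"
    using assms(2) by (rule cong_scalar_left)
  ultimately show ?thesis
    by (simp add: half_sum_def cong_def mult.assoc)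
qed

text \<open>Representatives are taken in \<open>{1..v}\<close> to match one-based row and column
  indices; the class of 0 is sent to \<open>v\<close>.\<close>

definition pos_residue :: "nat \<Rightarrow> int \<Rightarrow> nat" where
  "pos_residue v x = nat ((x - 1) mod int v) + 1"

lemma pos_residue_range: "v > 0 \<Longrightarrow> pos_residue v x \<in> {1..v}"
  using pos_mod_bound[of "int v" "x - 1"] by (auto simp: pos_residue_def nat_less_iff Suc_le_eq)

lemma pos_residue_cong: "v > 0 \<Longrightarrow> [int (pos_residue v x) = x] (mod int v)"
  by (simp add: pos_residue_def cong_def mod_simps)

lemma pos_residue_mod:
  assumes "v > 0"
  shows "(int k - int (pos_residue v (int k - y))) mod int v = y mod int v"
  using cong_diff[OF cong_refl[of "int k"] pos_residue_cong[OF assms, of "int k - y"]]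
  by (simp add: cong_def)

section \<open>Numbering of rows and symbols\<close>

text \<open>Row \<open>r\<close> of the array encodes the pair of the row \<open>block v r\<close> of the rectangle and the
  residue of \<open>r\<close> modulo \<open>v\<close>.\<close>

definition block :: "nat \<Rightarrow> nat \<Rightarrow> nat" where
  "block v r = (r - 1) div v + 1"

text \<open>The number standing for the symbol \<open>(x mod v, j)\<close>.\<close>

definition pair_symbol :: "nat \<Rightarrow> nat \<Rightarrow> nat \<Rightarrow> nat" where
  "pair_symbol v x j = v * (j - 1) + x mod v + 1"

text \<open>The full index \<open>r\<close> can stand for its residue because only \<open>r\<close>
  modulo \<open>v\<close> matters in \<open>k - r\<close> and \<open>k + r\<close>. When the row of
  \<open>D\<close> is injective, \<open>inv_into\<close> gives the unique column holding
  \<open>e\<close>.\<close>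

definition NHSLR_array ::
    "nat \<Rightarrow> nat \<Rightarrow> (nat \<Rightarrow> nat \<Rightarrow> int) \<Rightarrow> nat \<Rightarrow> nat \<Rightarrow> nat option" where
  "NHSLR_array v b D r k =
     (let e = (int k - int r) mod int v; i = block v r in
      if e \<in> D i ` {1..b} then Some (pair_symbol v (k + r) (inv_into {1..b} (D i) e)) else None)"

lemma block_range:
  assumes "r \<in> {1..v * g}"
  shows "block v r \<in> {1..g}"
  using assms by (auto simp: block_def Suc_le_eq less_mult_imp_div_less mult.commute)

lemma block_add:
  assumes "i \<ge> 1" "x \<in> {1..v}"
  shows "block v (v * (i - 1) + x) = i"
proof -
  have "v * (i - 1) + x - 1 = v * (i - 1) + (x - 1)"
    using assms(2) by simp
  moreover have "(v * (i - 1) + (x - 1)) div v = i - 1 + (x - 1) div v"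
    using assms(2) by (intro div_mult_self4) auto
  moreover have "(x - 1) div v = 0"
    using assms(2) by auto
  ultimately show ?thesis
    using assms(1) by (simp only: block_def)
qed

text \<open>Division with remainder applied to \<open>r - 1\<close>: the block fixes the quotient
  and the congruence fixes the remainder.\<close>

lemma block_cong_unique:
  assumes "r \<ge> 1" "r' \<ge> 1" "block v r = block v r'" "[int r = int r'] (mod int v)"
  shows "r = r'"
proof -
  have "[r - 1 + 1 = r' - 1 + 1] (mod v)"
    using assms(1,2,4) by (simp add: cong_int_iff)
  then have "[r - 1 = r' - 1] (mod v)"
    by (simp only: cong_add_rcancel_nat)
  with assms(1-3) show ?thesis
    by (metis block_def add_right_cancel cong_def div_mult_mod_eq le_add_diff_inverse2)
qed

lemma pair_symbol_inject:
  assumes "v > 0" "j \<ge> 1" "j' \<ge> 1" "pair_symbol v x j = pair_symbol v x' j'"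
  shows "j = j'" "x mod v = x' mod v"
proof -
  have eq: "x mod v + v * (j - 1) = x' mod v + v * (j' - 1)"
    using assms(4) by (simp add: pair_symbol_def)
  from arg_cong[OF this, of "\<lambda>n. n mod v"] show "x mod v = x' mod v" by simp
  with eq assms show "j = j'" by simp
qed

lemma pair_symbol_range:
  assumes "v > 0" "j \<in> {1..b}"
  shows "pair_symbol v x j \<in> {1..b * v}"
proof -
  have "v * (j - 1) + x mod v + 1 \<le> v * (j - 1) + v"
    using assms(1) by (simp add: Suc_le_eq)
  also have "\<dots> = v * j"
    using assms(2) by (cases j) auto
  also have "\<dots> \<le> b * v"
    using assms(2) by (simp add: mult.commute)
  finally show ?thesis by (simp add: pair_symbol_def)
qed

lemma pair_symbol_surj:
  assumes "v > 0" "s \<in> {1..b * v}"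
  obtains x j where "j \<in> {1..b}" "s = pair_symbol v x j"
proof
  show "(s - 1) div v + 1 \<in> {1..b}"
    using assms by (auto simp: Suc_le_eq less_mult_imp_div_less)
  \<comment> \<open>\<open>pair_symbol\<close> reduces its argument modulo \<open>v\<close>, so
    \<open>s - 1\<close> itself serves as \<open>x\<close>.\<close>
  show "s = pair_symbol v (s - 1) ((s - 1) div v + 1)"
    using assms by (simp add: pair_symbol_def)
qed

lemma NHSLR_array_SomeD:
  assumes "NHSLR_array v b D r k = Some s"
  obtains j where "j \<in> {1..b}" "D (block v r) j = (int k - int r) mod int v"
    "s = pair_symbol v (k + r) j"
proof -
  define e where "e = (int k - int r) mod int v"
  have "e \<in> D (block v r) ` {1..b}" "s = pair_symbol v (k + r) (inv_into {1..b} (D (block v r)) e)"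
    using assms by (auto simp: NHSLR_array_def Let_def e_def split: if_splits)
  then show thesis
    by (intro that[OF inv_into_into]) (auto simp: f_inv_into_f e_def)
qed

lemma NHSLR_array_SomeI:
  assumes "inj_on (D (block v r)) {1..b}" "j \<in> {1..b}"
    "D (block v r) j = (int k - int r) mod int v"
  shows "NHSLR_array v b D r k = Some (pair_symbol v (k + r) j)"
  using inv_into_f_f[OF assms(1,2)] assms(2) by (simp add: NHSLR_array_def Let_def flip: assms(3))

lemma NHSLR_array_None_iff:
  "NHSLR_array v b D r k = None \<longleftrightarrow> (int k - int r) mod int v \<notin> D (block v r) ` {1..b}"
  by (auto simp: NHSLR_array_def Let_def)

context
  fixes v g b D
  assumes v: "v > 0" "odd v" and g: "g > 0" and D: "is_NHSLR v g b D"
begin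

section \<open>Counting the stars of a column\<close>

lemma inj_row: "i \<in> {1..g} \<Longrightarrow> inj_on (D i) {1..b}"
  using D unfolding is_NHSLR_def by blast

lemma entry_mod: "i \<in> {1..g} \<Longrightarrow> j \<in> {1..b} \<Longrightarrow> D i j mod int v = D i j"
  using D by (auto simp: is_NHSLR_def)

text \<open>A row holds \<open>b\<close> distinct residues modulo \<open>v\<close>. The bound makes
  the truncated subtraction \<open>v - b\<close> exact in the memory ratio.\<close>

lemma NHSLR_width_le: "b \<le> v"
proof -
  have "card {1..b} \<le> card {0..<int v}"
    by (rule card_inj_on_le[OF inj_row[of 1]]) (use D g in \<open>auto simp: is_NHSLR_def\<close>)
  then show ?thesis by simp
qed

text \<open>In a fixed column \<open>k\<close>, non-star cells correspond to positions
  \<open>(i, j)\<close> of \<open>D\<close>: the entry forces the residue \<open>k - D i j\<close>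
  of the row index within block \<open>i\<close>, and \<open>h\<close> is this
  correspondence.\<close>

lemma card_NHSLR_array_Some:
  "card {r \<in> {1..v * g}. NHSLR_array v b D r k \<noteq> None} = b * g"
proof -
  define h where "h = (\<lambda>(i, j). v * (i - 1) + pos_residue v (int k - D i j))"
  have block_h: "block v (h (i, j)) = i" if "i \<in> {1..g}" for i j
    using that block_add pos_residue_range[OF v(1)] by (simp add: h_def)
  have h_mod: "(int k - int (h (i, j))) mod int v = D i j"
    if "i \<in> {1..g}" "j \<in> {1..b}" for i j
  proof -
    have "(int k - int (h (i, j))) mod int v =
        (int k - int (pos_residue v (int k - D i j)) + int v * (- int (i - 1))) mod int v"
      by (simp add: h_def diff_diff_add add.commute)
    also have "\<dots> = (int k - int (pos_residue v (int k - D i j))) mod int v"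
      by (rule mod_mult_self2)
    finally show ?thesis
      using entry_mod[OF that] by (simp add: pos_residue_mod[OF v(1)])
  qed
  have h_range: "h (i, j) \<in> {1..v * g}" if "i \<in> {1..g}" for i j
  proof -
    have "h (i, j) \<le> v * (i - 1) + v"
      using pos_residue_range[OF v(1)] by (simp add: h_def)
    also have "\<dots> = v * i"
      using that by (cases i) auto
    also have "\<dots> \<le> v * g"
      using that by simp
    finally show ?thesis by (simp add: h_def pos_residue_def)
  qed
  have "bij_betw h ({1..g} \<times> {1..b}) {r \<in> {1..v * g}. NHSLR_array v b D r k \<noteq> None}"
    unfolding bij_betw_def
  proof (intro conjI inj_onI equalityI subsetI)
    fix p q assume pq: "p \<in> {1..g} \<times> {1..b}" "q \<in> {1..g} \<times> {1..b}" "h p = h q"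
    obtain i j i' j' where ij: "p = (i, j)" "q = (i', j')"
      by (cases p, cases q)
    with pq have i: "i \<in> {1..g}" "i' \<in> {1..g}" and j: "j \<in> {1..b}" "j' \<in> {1..b}"
      and eq: "h (i, j) = h (i', j')"
      by auto
    have "i = i'"
      using arg_cong[OF eq, of "block v"] block_h i by simp
    moreover have "D i j = D i' j'"
      using arg_cong[OF eq, of "\<lambda>r. (int k - int r) mod int v"] h_mod i j by simp
    ultimately have "j = j'"
      using inj_onD[OF inj_row[OF i(1)] _ j] by simp
    with \<open>i = i'\<close> show "p = q"
      by (simp add: ij)
  next
    fix r assume "r \<in> h ` ({1..g} \<times> {1..b})"
    then show "r \<in> {r \<in> {1..v * g}. NHSLR_array v b D r k \<noteq> None}"
      using h_range by (auto simp: NHSLR_array_None_iff h_mod block_h simp del: not_None_eq)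
  next
    fix r assume "r \<in> {r \<in> {1..v * g}. NHSLR_array v b D r k \<noteq> None}"
    then have r: "r \<in> {1..v * g}" and "(int k - int r) mod int v \<in> D (block v r) ` {1..b}"
      by (auto simp: NHSLR_array_None_iff simp del: not_None_eq)
    then obtain j where j: "j \<in> {1..b}" "D (block v r) j = (int k - int r) mod int v"
      by auto
    let ?i = "block v r"
    have i: "?i \<in> {1..g}"
      using r by (rule block_range)
    have "[int k - int r = int k - int (h (?i, j))] (mod int v)"
      using h_mod[OF i j(1)] j(2) by (simp add: cong_def)
    from cong_diff[OF cong_refl[of "int k"] this]
    have "[int r = int (h (?i, j))] (mod int v)"
      by simp
    then have "r = h (?i, j)"
      using block_cong_unique[of r "h (?i, j)" v] r h_range[OF i] block_h[OF i] by simp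
    then show "r \<in> h ` ({1..g} \<times> {1..b})"
      using i j(1) by blast
  qed
  from bij_betw_same_card[OF this] show ?thesis
    by (simp add: mult.commute)
qed

lemma card_NHSLR_array_None:
  "card {r \<in> {1..v * g}. NHSLR_array v b D r k = None} = (v - b) * g"
proof -
  have "{r \<in> {1..v * g}. NHSLR_array v b D r k = None} =
      {1..v * g} - {r \<in> {1..v * g}. NHSLR_array v b D r k \<noteq> None}"
    by auto
  also have "card \<dots> = v * g - b * g"
    by (subst card_Diff_subset) (auto simp: card_NHSLR_array_Some[simplified])
  finally show ?thesis
    by (simp add: diff_mult_distrib)
qed

section \<open>Occurrence and repetition of symbols\<close>

lemma NHSLR_array_symbol_occurs:
  assumes "s \<in> {1..b * v}"
  shows "\<exists>r\<in>{1..v * g}. \<exists>k\<in>{1..v}. NHSLR_array v b D r k = Some s"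
proof -
  obtain x j where j: "j \<in> {1..b}" and s: "s = pair_symbol v x j"
    using pair_symbol_surj[OF v(1) assms] .
  define u where "u = modular_inverse (int v) 2"
  have "coprime 2 (int v)"
    using v by simp
  then have u: "[2 * u = 1] (mod int v)"
    unfolding u_def by (rule cong_modular_inverse1)
  \<comment> \<open>With \<open>u\<close> the inverse of 2, these solve \<open>k + r = x\<close> and
    \<open>k - r = D 1 j\<close> modulo \<open>v\<close>. Taking \<open>r\<close> in
    \<open>{1..v}\<close> puts it in the first block.\<close>
  define k where "k = pos_residue v (u * (int x + D 1 j))"
  define r where "r = pos_residue v (u * (int x - D 1 j))"
  have k: "k \<in> {1..v}" and r: "r \<in> {1..v}"
    by (simp_all only: k_def r_def pos_residue_range[OF v(1)])
  have kc: "[int k = u * (int x + D 1 j)] (mod int v)"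
    and rc: "[int r = u * (int x - D 1 j)] (mod int v)"
    by (simp_all only: k_def r_def pos_residue_cong[OF v(1)])
  have "[int k - int r = 2 * u * D 1 j] (mod int v)"
    using cong_diff[OF kc rc] by (simp add: algebra_simps)
  also have "[2 * u * D 1 j = 1 * D 1 j] (mod int v)"
    by (intro cong_mult u cong_refl)
  finally have diff: "D 1 j = (int k - int r) mod int v"
    using entry_mod[of 1 j] g j by (simp add: cong_def)
  have "[int k + int r = 2 * u * int x] (mod int v)"
    using cong_add[OF kc rc] by (simp add: algebra_simps)
  also have "[2 * u * int x = 1 * int x] (mod int v)"
    by (intro cong_mult u cong_refl)
  finally have "[k + r = x] (mod v)"
    by (simp flip: cong_int_iff)
  then have "s = pair_symbol v (k + r) j"
    by (simp add: s pair_symbol_def cong_def)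
  moreover have "block v r = 1"
    using block_add[of 1 r v] r by simp
  ultimately have "NHSLR_array v b D r k = Some s"
    using NHSLR_array_SomeI[of D v r b j k] inj_row[of 1] g j diff by simp
  moreover have "r \<in> {1..v * g}"
    using r g by (auto intro: order_trans[of r v "v * g"])
  ultimately show ?thesis
    using k by blast
qed

text \<open>Modulo \<open>v\<close>, if \<open>k\<^sub>1 + r\<^sub>1 = k\<^sub>2 + r\<^sub>2\<close>, then both \<open>k\<^sub>2 - r\<^sub>1\<close> and \<open>k\<^sub>1 - r\<^sub>2\<close> are the half-sum of
  \<open>k\<^sub>1 - r\<^sub>1\<close> and \<open>k\<^sub>2 - r\<^sub>2\<close>.\<close>

lemma NHSLR_array_same_symbol:
  assumes r: "r\<^sub>1 \<in> {1..v * g}" "r\<^sub>2 \<in> {1..v * g}" and k: "k\<^sub>1 \<in> {1..v}" "k\<^sub>2 \<in> {1..v}"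
    and ne: "(r\<^sub>1, k\<^sub>1) \<noteq> (r\<^sub>2, k\<^sub>2)"
    and s: "NHSLR_array v b D r\<^sub>1 k\<^sub>1 = Some s" "NHSLR_array v b D r\<^sub>2 k\<^sub>2 = Some s"
  shows "r\<^sub>1 \<noteq> r\<^sub>2 \<and> k\<^sub>1 \<noteq> k\<^sub>2 \<and> NHSLR_array v b D r\<^sub>1 k\<^sub>2 = None"
proof -
  let ?i1 = "block v r\<^sub>1" and ?i2 = "block v r\<^sub>2"
  have i: "?i1 \<in> {1..g}" "?i2 \<in> {1..g}"
    using r block_range by blast+
  obtain j where j: "j \<in> {1..b}" and D1: "D ?i1 j = (int k\<^sub>1 - int r\<^sub>1) mod int v"
    and s1: "s = pair_symbol v (k\<^sub>1 + r\<^sub>1) j"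
    using NHSLR_array_SomeD[OF s(1)] .
  obtain j' where j': "j' \<in> {1..b}" and D2': "D ?i2 j' = (int k\<^sub>2 - int r\<^sub>2) mod int v"
    and s2: "s = pair_symbol v (k\<^sub>2 + r\<^sub>2) j'"
    using NHSLR_array_SomeD[OF s(2)] .
  have "j = j'" and "[k\<^sub>1 + r\<^sub>1 = k\<^sub>2 + r\<^sub>2] (mod v)"
    using pair_symbol_inject[OF v(1) _ _ trans[OF s1[symmetric] s2]] j j' by (auto simp: cong_def)
  then have D2: "D ?i2 j = (int k\<^sub>2 - int r\<^sub>2) mod int v"
    and sum: "[int k\<^sub>1 + int r\<^sub>1 = int k\<^sub>2 + int r\<^sub>2] (mod int v)"
    using D2' by (simp_all flip: cong_int_iff)
  have D1c: "[D ?i1 j = int k\<^sub>1 - int r\<^sub>1] (mod int v)" and D2c: "[D ?i2 j = int k\<^sub>2 - int r\<^sub>2] (mod int v)"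
    using D1 D2 by (simp_all add: cong_def)
  have k_eq: "k\<^sub>1 = k\<^sub>2" if "[int k\<^sub>1 = int k\<^sub>2] (mod int v)"
  proof -
    \<comment> \<open>The shift moves \<open>{1..v}\<close> to \<open>{0..<v}\<close>, where
      reduction modulo \<open>v\<close> is the identity.\<close>
    have "[int k\<^sub>1 - 1 = int k\<^sub>2 - 1] (mod int v)"
      using that by (intro cong_diff cong_refl)
    with k show ?thesis by (auto simp: cong_def)
  qed
  have two: "coprime 2 (int v)"
    using v by simp
  have inj_col: "inj_on (\<lambda>i. D i j) {1..g}"
    using D j by (simp add: is_NHSLR_def)
  \<comment> \<open>In a common block the two differences would be the same entry of
    \<open>D\<close>. Equal sums and differences, with 2 invertible, would make the cells
    coincide.\<close>
  have blocks: "?i1 \<noteq> ?i2"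
  proof
    assume eq: "?i1 = ?i2"
    then have diff: "[int k\<^sub>1 - int r\<^sub>1 = int k\<^sub>2 - int r\<^sub>2] (mod int v)"
      using D1 D2 by (simp add: cong_def)
    have "[2 * int k\<^sub>1 = 2 * int k\<^sub>2] (mod int v)"
      using cong_add[OF sum diff] by (simp add: algebra_simps)
    then have "k\<^sub>1 = k\<^sub>2"
      using two k_eq by (simp add: cong_mult_lcancel coprime_commute)
    moreover have "[2 * int r\<^sub>1 = 2 * int r\<^sub>2] (mod int v)"
      using cong_diff[OF sum diff] by (simp add: algebra_simps)
    then have "[int r\<^sub>1 = int r\<^sub>2] (mod int v)"
      using two by (simp add: cong_mult_lcancel coprime_commute)
    then have "r\<^sub>1 = r\<^sub>2"
      using block_cong_unique[OF _ _ eq] r by simp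
    ultimately show False
      using ne by simp
  qed
  \<comment> \<open>Equal columns would force congruent rows, hence a repeated entry in column
    \<open>j\<close> of \<open>D\<close>.\<close>
  have "k\<^sub>1 \<noteq> k\<^sub>2"
  proof
    assume eq: "k\<^sub>1 = k\<^sub>2"
    then have "[int r\<^sub>1 = int r\<^sub>2] (mod int v)"
      using sum by (simp add: cong_add_lcancel)
    from cong_diff[OF cong_refl[of "int k\<^sub>1"] this]
    have "D ?i1 j = D ?i2 j"
      using D1 D2 eq by (simp only: cong_def)
    then show False
      using inj_onD[OF inj_col _ i] blocks by blast
  qed
  moreover have "half_sum v (D ?i1 j) (D ?i2 j) = (int k\<^sub>2 - int r\<^sub>1) mod int v"
  proof (rule half_sum_cong[OF v(2)])
    have "[D ?i1 j + D ?i2 j = (int k\<^sub>1 - int r\<^sub>1) + (int k\<^sub>2 - int r\<^sub>2)] (mod int v)"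
      by (rule cong_add[OF D1c D2c])
    \<comment> \<open>The added term is chosen to turn the left side into the sum of the two entries
      and the right side into \<open>2 * (k\<^sub>2 - r\<^sub>1)\<close>.\<close>
    moreover have "[(int k\<^sub>1 + int r\<^sub>1) + (int k\<^sub>2 - int r\<^sub>2 - 2 * int r\<^sub>1) =
        (int k\<^sub>2 + int r\<^sub>2) + (int k\<^sub>2 - int r\<^sub>2 - 2 * int r\<^sub>1)] (mod int v)"
      by (rule cong_add[OF sum cong_refl])
    then have "[(int k\<^sub>1 - int r\<^sub>1) + (int k\<^sub>2 - int r\<^sub>2) = 2 * (int k\<^sub>2 - int r\<^sub>1)] (mod int v)"
      by (simp add: algebra_simps)
    ultimately show "[D ?i1 j + D ?i2 j = 2 * (int k\<^sub>2 - int r\<^sub>1)] (mod int v)"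
      by (rule cong_trans)
  qed
  moreover have "half_sum v (D ?i1 j) (D ?i2 j) \<notin> D ?i1 ` {1..b}"
  proof -
    have "\<forall>i\<in>{1..g}. \<forall>i'\<in>{1..g}. i \<noteq> i' \<longrightarrow>
        (\<forall>j\<in>{1..b}. half_sum v (D i j) (D i' j) \<notin> D i ` {1..b} \<union> D i' ` {1..b})"
      using D unfolding is_NHSLR_def by (elim conjE)
    with i j blocks show ?thesis by blast
  qed
  moreover have "r\<^sub>1 \<noteq> r\<^sub>2"
    using blocks by blast
  ultimately show ?thesis
    by (simp only: NHSLR_array_None_iff) simp
qed

lemma is_PDA_NHSLR_array: "is_PDA v (v * g) ((v - b) * g) (b * v) (NHSLR_array v b D)"
  unfolding is_PDA_def
proof (intro conjI ballI allI impI)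
  fix r k
  show "NHSLR_array v b D r k \<in> insert None (Some ` {1..b * v})"
    using pair_symbol_range[OF v(1)] by (cases "NHSLR_array v b D r k") (auto elim!: NHSLR_array_SomeD)
next
  fix k
  show "card {r \<in> {1..v * g}. NHSLR_array v b D r k = None} = (v - b) * g"
    by (rule card_NHSLR_array_None)
next
  fix s assume "s \<in> {1..b * v}"
  then show "\<exists>r\<in>{1..v * g}. \<exists>k\<in>{1..v}. NHSLR_array v b D r k = Some s"
    by (rule NHSLR_array_symbol_occurs)
next
  fix r\<^sub>1 k\<^sub>1 r\<^sub>2 k\<^sub>2 s
  assume cells: "r\<^sub>1 \<in> {1..v * g}" "k\<^sub>1 \<in> {1..v}" "r\<^sub>2 \<in> {1..v * g}" "k\<^sub>2 \<in> {1..v}"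
    and same: "(r\<^sub>1, k\<^sub>1) \<noteq> (r\<^sub>2, k\<^sub>2) \<and> NHSLR_array v b D r\<^sub>1 k\<^sub>1 = Some s \<and>
      NHSLR_array v b D r\<^sub>2 k\<^sub>2 = Some s"
  show "r\<^sub>1 \<noteq> r\<^sub>2" "k\<^sub>1 \<noteq> k\<^sub>2" "NHSLR_array v b D r\<^sub>1 k\<^sub>2 = None"
    using NHSLR_array_same_symbol[of r\<^sub>1 r\<^sub>2 k\<^sub>1 k\<^sub>2 s] cells same by blast+
  \<comment> \<open>The other corner follows by exchanging the two cells.\<close>
  show "NHSLR_array v b D r\<^sub>2 k\<^sub>1 = None"
    using NHSLR_array_same_symbol[of r\<^sub>2 r\<^sub>1 k\<^sub>2 k\<^sub>1 s] cells same by blast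
qed

end

theorem theorem1:
  fixes v g b :: nat
  assumes "v > 0" and "odd v" and "g > 0" and "b > 0"
    and "\<exists>D. is_NHSLR v g b D"
  shows "\<exists>P. is_PDA v (v * g) ((v - b) * g) (b * v) P \<and>
           (\<forall>N>0. \<exists>M::real.
              M / real N = 1 - real b / real v \<and>
              is_division_scheme v M N (v * g) (PDA_scheme v (v * g) (b * v) P N) \<and>
              load v N (v * g) (PDA_scheme v (v * g) (b * v) P N) = real b / real g)"
proof -
  obtain D where D: "is_NHSLR v g b D"
    using assms by blast
  let ?P = "NHSLR_array v b D"
  have PDA: "is_PDA v (v * g) ((v - b) * g) (b * v) ?P"
    using assms(1-3) D by (rule is_PDA_NHSLR_array)
  have "b \<le> v"
    using assms(1-3) D by (rule NHSLR_width_le)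
  then have ratio: "real ((v - b) * g) / real (v * g) = 1 - real b / real v"
    using assms by (simp add: field_simps)
  have "\<exists>M::real. M / real N = 1 - real b / real v \<and>
      is_division_scheme v M N (v * g) (PDA_scheme v (v * g) (b * v) ?P N) \<and>
      load v N (v * g) (PDA_scheme v (v * g) (b * v) ?P N) = real b / real g"
    if "N > 0" for N
    using is_division_scheme_PDA_scheme[OF PDA, of N] load_PDA_scheme[of N v "v * g" "b * v" ?P]
      that assms(1,3) unfolding ratio
    \<comment> \<open>The load is \<open>b * v / (v * g)\<close>, in which \<open>v\<close>
      cancels.\<close>
    by (intro exI[of _ "real N * (1 - real b / real v)"]) simp
  with PDA show ?thesis
    by blast
qed

end
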